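(* Let $Cay(H,S)$ be a Cayley digraph of order $n$. Let $\{\chi_i\}_{i=1,2,\dots,n}$ be the set of all distinct characters on $H$ such that $\chi_1$ is the trivial one. Define $$n_*=\frac{n}{|S|}\left(\max_{2\leq i\leq n}\Big|\sum_{s\in S}\chi_i(s)\Big|\right)$$ and let $X,Y$ be subsets of vertices of $Cay(H,S)$. If $\sqrt{|X||Y|}>n_*$, then there exists a directed edge between a vertex in $X$ and a vertex in $Y$. In particular, if $|X|>n_*$, then there exist at least two distinct vertices of $X$ with a directed edge between them.
   Context: Let $H$ be a finite abelian group and $S$ a subset of $H$. The Cayley digraph $Cay(H,S)$ is the digraph with vertex set $H$ in which there is a directed edge $u\to v$ if and only if $v-u\in S$; its order is the number of its vertices, $n=|H|$. A character of $H$ is a group homomorphism $\chi:H\to\mathbb{C}^{*}$ into the multiplicative group of nonzero complex numbers; the trivial character is the one with $\chi(h)=1$ for every $h\in H$. The bars around the character sum denote the complex absolute value.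
   Formalization: The "in particular" sentence is proved only for 0 not in S (no loops), since it fails otherwise, e.g. S = H of order 2 and |X| = 1, where n_* = 0; S is taken nonempty so that n_* is defined. *)

theory Defs
  imports
    Complex_Main
    "HOL-Algebra.Algebraic_Closure_Type"
    "Graph_Theory.Pair_Digraph"
begin

text \<open>Groups are written multiplicatively, so the difference \<open>v - u\<close> becomes \<open>v \<otimes> inv u\<close>.
  Loops are allowed: there is one at every vertex iff \<open>\<one> \<in> S\<close>.\<close>

definition Cay :: "('a, 'b) monoid_scheme \<Rightarrow> 'a set \<Rightarrow> 'a pair_pre_digraph" where
  "Cay H S = \<lparr> pverts = carrier H,
     parcs = {(u, v). u \<in> carrier H \<and> v \<in> carrier H \<and> v \<otimes>\<^bsub>H\<^esub> inv\<^bsub>H\<^esub> u \<in> S} \<rparr>"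

text \<open>Extensionality makes distinct elements of this set distinct as functions on the carrier.\<close>

definition characters :: "('a, 'b) monoid_scheme \<Rightarrow> ('a \<Rightarrow> complex) set" where
  "characters H = hom H (mult_of (ring_of_type_algebra :: complex ring)) \<inter> extensional (carrier H)"

text \<open>For \<open>n = 1\<close> there is no nontrivial character; the empty maximum of absolute values is
  read as \<open>0\<close>.\<close>

definition n_star :: "nat \<Rightarrow> 'a set \<Rightarrow> (nat \<Rightarrow> 'a \<Rightarrow> complex) \<Rightarrow> real" where
  "n_star n S chi = real n / real (card S) *
     (if n = 1 then 0 else (MAX i\<in>{2..n}. cmod (\<Sum>s\<in>S. chi i s)))"

lemma pair_fin_digraph_Cay:
  assumes "finite (carrier H)"
  shows "pair_fin_digraph (Cay H S)"
proof
  show "finite (parcs (Cay H S))"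
    by (rule finite_subset[of _ "carrier H \<times> carrier H"]) (use assms in \<open>auto simp: Cay_def\<close>)
qed (use assms in \<open>auto simp: Cay_def\<close>)

lemma characters_iff:
  "chi \<in> characters H \<longleftrightarrow> chi \<in> extensional (carrier H) \<and> (\<forall>x\<in>carrier H. chi x \<noteq> 0) \<and>
     (\<forall>x\<in>carrier H. \<forall>y\<in>carrier H. chi (x \<otimes>\<^bsub>H\<^esub> y) = chi x * chi y)"
  by (auto simp: characters_def hom_def ring_of_type_algebra_def)

end

theory Submission
  imports Defs "HOL-Analysis.L2_Norm"
begin

text \<open>Write \<open>T(c)\<close> for the sum of a character \<open>c\<close> over a set \<open>T\<close>.  The number of triples
  \<open>(s, a, b)\<close> in \<open>S \<times> A \<times> B\<close> with \<open>s \<otimes> a = b\<close> is \<open>1/n\<close> times the sum over all characters \<open>c\<close> of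
  \<open>S(c) * A(c) * cnj (B(c))\<close>.  If there is no edge from \<open>A\<close> to \<open>B\<close>, the term \<open>|S| |A| |B|\<close> of the
  trivial character is cancelled by the others, which Cauchy--Schwarz and Parseval bound by
  \<open>max |S(c)| * n * sqrt (|A| |B|)\<close>.

  That \<open>\<Sum>c. c h = 0\<close> for \<open>h \<noteq> \<one>\<close> needs no structure theory of abelian groups once there are \<open>n\<close>
  characters: by row orthogonality the function \<open>F h = \<Sum>c. c h\<close> satisfies
  \<open>\<Sum>h. |F h|\<^sup>2 = n\<^sup>2\<close>, and already \<open>F \<one> = n\<close>.\<close>

text \<open>Used with \<open>i\<close> ranging over the nontrivial characters, \<open>w\<close> the
  absolute sums over \<open>S\<close>, and \<open>f\<close>, \<open>g\<close> those over
  \<open>A\<close> and \<open>B\<close>.\<close>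

lemma Cauchy_Schwarz_weighted:
  fixes f g w :: "'i \<Rightarrow> real"
  assumes "\<And>i. i \<in> I \<Longrightarrow> \<bar>w i\<bar> \<le> M" and "0 \<le> M"
  shows "\<bar>\<Sum>i\<in>I. w i * f i * g i\<bar> \<le> M * sqrt ((\<Sum>i\<in>I. (f i)\<^sup>2) * (\<Sum>i\<in>I. (g i)\<^sup>2))"
proof -
  have "\<bar>\<Sum>i\<in>I. w i * f i * g i\<bar> \<le> (\<Sum>i\<in>I. M * (\<bar>f i\<bar> * \<bar>g i\<bar>))"
    by (rule order.trans[OF sum_abs sum_mono])
       (use assms in \<open>auto simp: abs_mult mult.assoc intro!: mult_right_mono\<close>)
  also have "\<dots> = M * (\<Sum>i\<in>I. \<bar>f i\<bar> * \<bar>g i\<bar>)"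
    by (simp add: sum_distrib_left)
  also have "(\<Sum>i\<in>I. \<bar>f i\<bar> * \<bar>g i\<bar>) \<le> sqrt ((\<Sum>i\<in>I. (f i)\<^sup>2) * (\<Sum>i\<in>I. (g i)\<^sup>2))"
    using L2_set_mult_ineq[of f g I] by (simp add: L2_set_def real_sqrt_mult)
  finally show ?thesis
    using \<open>0 \<le> M\<close> by (simp add: mult_left_mono)
qed

context comm_group
begin

section \<open>Values of a character on a finite group\<close>

lemma character_mult:
  "c \<in> characters G \<Longrightarrow> x \<in> carrier G \<Longrightarrow> y \<in> carrier G \<Longrightarrow> c (x \<otimes> y) = c x * c y"
  by (auto simp: characters_iff)

lemma character_one: "c \<in> characters G \<Longrightarrow> c \<one> = 1"
  using character_mult[of c \<one> \<one>] by (auto simp: characters_iff)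

lemma character_pow: "c \<in> characters G \<Longrightarrow> x \<in> carrier G \<Longrightarrow> c (x [^] (k::nat)) = c x ^ k"
  by (induction k) (auto simp: character_one character_mult)

text \<open>Raising \<open>x\<close> to the group order gives the identity, so \<open>c x\<close> is
  a root of unity.\<close>

lemma norm_character:
  assumes "finite (carrier G)" "c \<in> characters G" "x \<in> carrier G"
  shows "cmod (c x) = 1"
proof -
  have "c x ^ Coset.order G = 1"
    using character_pow[of c x "Coset.order G"] assms by (simp add: pow_order_eq_1 character_one)
  then show ?thesis
    using assms(1) order_gt_0_iff_finite by (metis power_eq_1_iff less_irrefl)
qed

lemma character_inv:
  assumes "finite (carrier G)" "c \<in> characters G" "x \<in> carrier G"
  shows "c (inv x) = cnj (c x)"
proof -
  have "c x * c (inv x) = 1"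
    using assms character_mult[of c x "inv x"] by (simp add: character_one)
  moreover have "c x * cnj (c x) = 1"
    using norm_character[OF assms] by (simp add: complex_norm_square[symmetric])
  moreover have "c x \<noteq> 0"
    using assms by (auto simp: characters_iff)
  ultimately show ?thesis
    by (metis mult_left_cancel)
qed

section \<open>Orthogonality relations and Parseval's identity\<close>

text \<open>If \<open>c\<close> and \<open>d\<close> differ at \<open>g\<close>, translation by
  \<open>g\<close> permutes the group and multiplies the sum by \<open>c g * cnj (d g)\<close>. This
  factor is not 1, so the sum vanishes.\<close>

lemma sum_characters_orthogonal:
  assumes fin: "finite (carrier G)" and c: "c \<in> characters G" and d: "d \<in> characters G"
  shows "(\<Sum>h\<in>carrier G. c h * cnj (d h)) = (if c = d then of_nat (Coset.order G) else 0)"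
proof (cases "c = d")
  case True
  then show ?thesis
    using norm_character[OF fin c] by (simp add: complex_norm_square[symmetric] Coset.order_def)
next
  case False
  then obtain g where g: "g \<in> carrier G" "c g \<noteq> d g"
    using c d by (metis characters_iff extensionalityI)
  define s where "s = (\<Sum>h\<in>carrier G. c h * cnj (d h))"
  have "d g * cnj (d g) = 1"
    using norm_character[OF fin d g(1)] by (simp add: complex_norm_square[symmetric])
  then have ne: "c g * cnj (d g) \<noteq> 1"
    using g(2) by (metis mult_cancel_right mult_zero_right zero_neq_one)
  have "bij_betw ((\<otimes>) g) (carrier G) (carrier G)"
    by (rule bij_betw_byWitness[where f' = "(\<otimes>) (inv g)"])
       (use g in \<open>auto simp: m_assoc[symmetric]\<close>)
  then have "s = (\<Sum>h\<in>carrier G. c (g \<otimes> h) * cnj (d (g \<otimes> h)))"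
    unfolding s_def by (rule sum.reindex_bij_betw[symmetric])
  also have "\<dots> = c g * cnj (d g) * s"
    unfolding s_def sum_distrib_left
    by (rule sum.cong) (use c d g in \<open>auto simp: character_mult\<close>)
  finally show ?thesis
    using ne False by (simp add: s_def)
qed

lemma sum_over_characters:
  assumes fin: "finite (carrier G)" and card: "card (characters G) = Coset.order G"
    and h: "h \<in> carrier G"
  shows "(\<Sum>c\<in>characters G. c h) = (if h = \<one> then of_nat (Coset.order G) else 0)"
proof -
  define F where "F h = (\<Sum>c\<in>characters G. c h)" for h
  \<comment> \<open>An infinite set would have cardinality 0, but the group order is
    positive.\<close>
  have finC: "finite (characters G)"
    using card fin order_gt_0_iff_finite by (metis card.infinite less_irrefl)
  have F1: "F \<one> = of_nat (Coset.order G)"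
    using card by (simp add: F_def character_one)
  have "complex_of_real (\<Sum>h\<in>carrier G. (cmod (F h))\<^sup>2) =
      (\<Sum>h\<in>carrier G. \<Sum>c\<in>characters G. \<Sum>d\<in>characters G. c h * cnj (d h))"
    by (simp only: of_real_sum complex_norm_square F_def sum_product cnj_sum)
  also have "\<dots> = (\<Sum>c\<in>characters G. \<Sum>d\<in>characters G. \<Sum>h\<in>carrier G. c h * cnj (d h))"
    by (subst sum.swap) (intro sum.cong refl sum.swap)
  also have "\<dots> = (\<Sum>c\<in>characters G. \<Sum>d\<in>characters G. if c = d then of_nat (Coset.order G) else 0)"
    by (intro sum.cong refl sum_characters_orthogonal fin)
  also have "\<dots> = of_real ((real (Coset.order G))\<^sup>2)"
    using finC card by (simp add: power2_eq_square)
  finally have "(\<Sum>h\<in>carrier G. (cmod (F h))\<^sup>2) = (cmod (F \<one>))\<^sup>2"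
    unfolding of_real_eq_iff F1 by simp
  then have "(\<Sum>h\<in>carrier G - {\<one>}. (cmod (F h))\<^sup>2) = 0"
    using fin by (simp add: sum.remove[of _ \<one>])
  then have "F h = 0" if "h \<noteq> \<one>"
    using that h fin by (subst (asm) sum_nonneg_eq_0_iff) auto
  then show ?thesis
    using F1 by (simp add: F_def)
qed

lemma sum_cnj_over_characters:
  assumes fin: "finite (carrier G)" and card: "card (characters G) = Coset.order G"
    and x: "x \<in> carrier G" and y: "y \<in> carrier G"
  shows "(\<Sum>c\<in>characters G. c x * cnj (c y)) = (if x = y then of_nat (Coset.order G) else 0)"
proof -
  have "(\<Sum>c\<in>characters G. c x * cnj (c y)) = (\<Sum>c\<in>characters G. c (x \<otimes> inv y))"
    by (rule sum.cong) (use fin x y in \<open>auto simp: character_mult character_inv\<close>)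
  moreover have "x \<otimes> inv y = \<one> \<longleftrightarrow> x = y"
    using x y by (metis inv_closed inv_equality inv_inv r_inv)
  ultimately show ?thesis
    using sum_over_characters[OF fin card, of "x \<otimes> inv y"] x y by simp
qed

text \<open>Expanding the square gives a double sum over \<open>a\<close> and \<open>b\<close>;
  summing over the characters first leaves only the diagonal.\<close>

lemma character_Parseval:
  assumes fin: "finite (carrier G)" and card: "card (characters G) = Coset.order G"
    and A: "A \<subseteq> carrier G"
  shows "(\<Sum>c\<in>characters G. (cmod (\<Sum>a\<in>A. c a))\<^sup>2) = real (Coset.order G) * real (card A)"
proof -
  have finA: "finite A"
    using A fin by (rule finite_subset)
  have "complex_of_real (\<Sum>c\<in>characters G. (cmod (\<Sum>a\<in>A. c a))\<^sup>2) =
      (\<Sum>c\<in>characters G. \<Sum>a\<in>A. \<Sum>b\<in>A. c a * cnj (c b))"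
    by (simp only: of_real_sum complex_norm_square sum_product cnj_sum)
  also have "\<dots> = (\<Sum>a\<in>A. \<Sum>b\<in>A. \<Sum>c\<in>characters G. c a * cnj (c b))"
    by (subst sum.swap) (intro sum.cong refl sum.swap)
  also have "\<dots> = (\<Sum>a\<in>A. \<Sum>b\<in>A. if a = b then of_nat (Coset.order G) else 0)"
    by (intro sum.cong refl sum_cnj_over_characters fin card) (use A in auto)
  also have "\<dots> = of_real (real (Coset.order G) * real (card A))"
    using finA by simp
  finally show ?thesis
    unfolding of_real_eq_iff .
qed

section \<open>Counting solutions of \<open>s \<otimes> a = b\<close> by characters\<close>

lemma sum_characters_no_solution:
  assumes fin: "finite (carrier G)" and card: "card (characters G) = Coset.order G"
    and sub: "S \<subseteq> carrier G" "A \<subseteq> carrier G" "B \<subseteq> carrier G"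
    and none: "\<And>s a. s \<in> S \<Longrightarrow> a \<in> A \<Longrightarrow> s \<otimes> a \<notin> B"
  shows "(\<Sum>c\<in>characters G. (\<Sum>s\<in>S. c s) * (\<Sum>a\<in>A. c a) * cnj (\<Sum>b\<in>B. c b)) = 0"
proof -
  have "(\<Sum>c\<in>characters G. (\<Sum>s\<in>S. c s) * (\<Sum>a\<in>A. c a) * cnj (\<Sum>b\<in>B. c b)) =
      (\<Sum>c\<in>characters G. \<Sum>s\<in>S. \<Sum>a\<in>A. \<Sum>b\<in>B. c s * c a * cnj (c b))"
    by (simp only: cnj_sum flip: sum_distrib_left sum_distrib_right)
  also have "\<dots> = (\<Sum>s\<in>S. \<Sum>a\<in>A. \<Sum>b\<in>B. \<Sum>c\<in>characters G. c s * c a * cnj (c b))"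
    \<comment> \<open>Each swap moves the sum over the characters one level inwards.\<close>
    by (subst sum.swap, rule sum.cong[OF refl], subst sum.swap, rule sum.cong[OF refl], rule sum.swap)
  also have "\<dots> = (\<Sum>s\<in>S. \<Sum>a\<in>A. \<Sum>b\<in>B. \<Sum>c\<in>characters G. c (s \<otimes> a) * cnj (c b))"
    by (intro sum.cong refl) (use sub in \<open>auto simp: character_mult subset_iff\<close>)
  also have "\<dots> = (\<Sum>s\<in>S. \<Sum>a\<in>A. \<Sum>b\<in>B. 0)"
  proof (intro sum.cong refl)
    fix s a b assume "s \<in> S" "a \<in> A" "b \<in> B"
    then show "(\<Sum>c\<in>characters G. c (s \<otimes> a) * cnj (c b)) = 0"
      using sub none[of s a] by (subst sum_cnj_over_characters[OF fin card]) auto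
  qed
  also have "\<dots> = 0"
    by simp
  finally show ?thesis .
qed

lemma expander_mixing_no_solution:
  assumes fin: "finite (carrier G)" and card: "card (characters G) = Coset.order G"
    and sub: "S \<subseteq> carrier G" "A \<subseteq> carrier G" "B \<subseteq> carrier G"
    and none: "\<And>s a. s \<in> S \<Longrightarrow> a \<in> A \<Longrightarrow> s \<otimes> a \<notin> B"
    and e: "e \<in> characters G" "\<And>h. h \<in> carrier G \<Longrightarrow> e h = 1"
    and M: "\<And>c. c \<in> characters G - {e} \<Longrightarrow> cmod (\<Sum>s\<in>S. c s) \<le> M" "0 \<le> M"
  shows "real (card S) * sqrt (real (card A) * real (card B)) \<le> real (Coset.order G) * M"
proof -
  define N where "N = real (Coset.order G)"
  define r where "r = sqrt (real (card A) * real (card B))"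
  define t where "t T c = (\<Sum>x\<in>T. c x)" for T and c :: "'a \<Rightarrow> complex"
  have finC: "finite (characters G)"
    using card fin order_gt_0_iff_finite by (metis card.infinite less_irrefl)
  have te: "t T e = of_nat (card T)" if "T \<subseteq> carrier G" for T
    using that e(2) by (simp add: t_def subset_iff)
  \<comment> \<open>Parseval with the nonnegative term of \<open>e\<close> dropped.\<close>
  have le: "(\<Sum>c\<in>characters G - {e}. (cmod (t T c))\<^sup>2) \<le> N * real (card T)"
    if "T \<subseteq> carrier G" for T
    using character_Parseval[OF fin card that] finC
      sum_mono2[of "characters G" "characters G - {e}" "\<lambda>c. (cmod (t T c))\<^sup>2"]
    by (simp add: t_def N_def)
  have "0 = (\<Sum>c\<in>characters G. t S c * t A c * cnj (t B c))"
    using sum_characters_no_solution[OF fin card sub none] by (simp add: t_def)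
  also have "\<dots> = t S e * t A e * cnj (t B e) +
      (\<Sum>c\<in>characters G - {e}. t S c * t A c * cnj (t B c))"
    using finC e(1) by (rule sum.remove)
  finally have "of_nat (card S * card A * card B) =
      - (\<Sum>c\<in>characters G - {e}. t S c * t A c * cnj (t B c))"
    using sub by (simp add: te eq_neg_iff_add_eq_0)
  then have "cmod (of_nat (card S * card A * card B)) =
      cmod (\<Sum>c\<in>characters G - {e}. t S c * t A c * cnj (t B c))"
    by (metis norm_minus_cancel)
  then have "real (card S * card A * card B) \<le>
      (\<Sum>c\<in>characters G - {e}. cmod (t S c) * cmod (t A c) * cmod (t B c))"
    using norm_sum[of "\<lambda>c. t S c * t A c * cnj (t B c)" "characters G - {e}"]
    by (simp only: norm_of_nat norm_mult complex_mod_cnj)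
  also have "\<dots> \<le> M * sqrt ((\<Sum>c\<in>characters G - {e}. (cmod (t A c))\<^sup>2) *
      (\<Sum>c\<in>characters G - {e}. (cmod (t B c))\<^sup>2))"
    by (rule order.trans[OF abs_ge_self Cauchy_Schwarz_weighted]) (use M in \<open>auto simp: t_def\<close>)
  also have "\<dots> \<le> M * sqrt ((N * real (card A)) * (N * real (card B)))"
    using M(2) le[OF sub(2)] le[OF sub(3)]
    by (intro mult_left_mono real_sqrt_le_mono mult_mono) (auto intro: sum_nonneg simp: N_def)
  also have "\<dots> = N * M * r"
    by (simp add: N_def r_def real_sqrt_mult)
  \<comment> \<open>The product of the sizes of \<open>A\<close> and \<open>B\<close> is
    \<open>r * r\<close>, so one factor \<open>r\<close> can be cancelled; for \<open>r = 0\<close>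
    the bound is just \<open>0 \<le> N * M\<close>.\<close>
  finally have "(real (card S) * r) * r \<le> N * M * r"
    by (simp add: r_def mult.assoc)
  moreover have "0 \<le> r" "0 \<le> N * M"
    using M(2) by (auto simp: r_def N_def)
  ultimately have "real (card S) * r \<le> N * M"
    by (cases "r = 0") auto
  then show ?thesis
    by (simp add: r_def N_def)
qed

text \<open>Edges from \<open>a\<close> to \<open>b\<close> correspond to solutions of
  \<open>s \<otimes> a = b\<close>, so a missing edge makes the mixing bound available; dividing it
  by the size of \<open>S\<close> contradicts \<open>less\<close>.\<close>

lemma Cay_edge_if_n_star_less:
  assumes fin: "finite (carrier G)"
    and S: "S \<subseteq> carrier G" "S \<noteq> {}"
    and bij: "bij_betw chi {1..Coset.order G} (characters G)"
    and triv: "\<And>h. h \<in> carrier G \<Longrightarrow> chi 1 h = 1"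
    and A: "A \<subseteq> carrier G" and B: "B \<subseteq> carrier G"
    and less: "n_star (Coset.order G) S chi < sqrt (real (card A) * real (card B))"
  shows "\<exists>x\<in>A. \<exists>y\<in>B. (x, y) \<in> parcs (Cay G S)"
proof (rule ccontr)
  assume neg: "\<not> ?thesis"
  define M where "M = (if Coset.order G = 1 then 0 else (MAX i\<in>{2..Coset.order G}. cmod (\<Sum>s\<in>S. chi i s)))"
  have pos: "Coset.order G > 0"
    using fin by (simp add: order_gt_0_iff_finite)
  have one: "1 \<in> {1..Coset.order G}"
    using pos by simp
  \<comment> \<open>The enumeration \<open>chi\<close> supplies the number of characters on which
    column orthogonality rests.\<close>
  have card: "card (characters G) = Coset.order G"
    using bij_betw_same_card[OF bij] by simp
  have M_ge: "cmod (\<Sum>s\<in>S. chi i s) \<le> M" if "i \<in> {2..Coset.order G}" for i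
    using that by (auto simp: M_def intro!: Max_ge)
  have M0: "0 \<le> M"
  proof (cases "Coset.order G = 1")
    \<comment> \<open>Now index 2 lies in the range, so \<open>M\<close> dominates a norm.\<close>
    case False
    then show ?thesis
      using M_ge[of 2] pos by (auto intro: order.trans[OF norm_ge_zero])
  qed (simp add: M_def)
  have Mc: "cmod (\<Sum>s\<in>S. c s) \<le> M" if "c \<in> characters G - {chi 1}" for c
  proof -
    have "c \<in> chi ` {1..Coset.order G}"
      using that bij_betw_imp_surj_on[OF bij] by simp
    then obtain i where "i \<in> {1..Coset.order G}" "c = chi i"
      by blast
    moreover from this that have "i \<noteq> 1" by auto
    ultimately show ?thesis
      using M_ge[of i] by auto
  qed
  have none: "s \<otimes> a \<notin> B" if "s \<in> S" "a \<in> A" for s a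
  proof
    assume "s \<otimes> a \<in> B"
    moreover have "s \<otimes> a \<otimes> inv a = s"
      using that S A by (simp add: m_assoc subset_iff)
    ultimately have "(a, s \<otimes> a) \<in> parcs (Cay G S)"
      using that A B by (auto simp: Cay_def)
    then show False
      using neg that \<open>s \<otimes> a \<in> B\<close> by blast
  qed
  have "chi 1 \<in> characters G"
    using bij_betwE[OF bij] one by blast
  then have "real (card S) * sqrt (real (card A) * real (card B)) \<le> real (Coset.order G) * M"
    by (intro expander_mixing_no_solution[where e = "chi 1"])
       (use fin card S(1) A B none triv Mc M0 in blast)+
  moreover have "card S > 0"
    using S fin by (simp add: card_gt_0_iff finite_subset)
  ultimately have "sqrt (real (card A) * real (card B)) \<le> n_star (Coset.order G) S chi"
    by (simp add: n_star_def M_def field_simps)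
  with less show False by simp
qed

end

text \<open>The second claim takes both sets equal to \<open>A\<close>. The condition that the
  identity is not in \<open>S\<close> excludes loops: in the trivial group with \<open>S\<close> the
  whole group, \<open>n_star\<close> is 0 but there is only one vertex. For empty \<open>S\<close>,
  division by zero would make \<open>n_star\<close> vanish although there are no edges.\<close>

theorem theorem2p2:
  fixes H :: "('a, 'b) monoid_scheme" and S A B :: "'a set"
    and chi :: "nat \<Rightarrow> 'a \<Rightarrow> complex" and n :: nat
  assumes "comm_group H" and "finite (carrier H)"
    and "S \<subseteq> carrier H" and "S \<noteq> {}"
    and "n = card (pverts (Cay H S))"
    and "bij_betw chi {1..n} (characters H)"
    and "\<forall>h\<in>carrier H. chi 1 h = 1"
    and "A \<subseteq> pverts (Cay H S)" and "B \<subseteq> pverts (Cay H S)"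
  shows "(sqrt (real (card A) * real (card B)) > n_star n S chi \<longrightarrow>
           (\<exists>x\<in>A. \<exists>y\<in>B. (x, y) \<in> parcs (Cay H S)))
       \<and> (\<one>\<^bsub>H\<^esub> \<notin> S \<and> real (card A) > n_star n S chi \<longrightarrow>
           (\<exists>x\<in>A. \<exists>y\<in>A. x \<noteq> y \<and> (x, y) \<in> parcs (Cay H S)))"
proof -
  interpret comm_group H by fact
  have n: "n = Coset.order H"
    using assms(5) by (simp add: Cay_def Coset.order_def)
  have sub: "A \<subseteq> carrier H" "B \<subseteq> carrier H"
    using assms(8,9) by (auto simp: Cay_def)
  \<comment> \<open>\<open>B'\<close> is instantiated with \<open>B\<close> and with
    \<open>A\<close>; in the latter case the square root is the size of \<open>A\<close>.\<close>
  have edge: "\<exists>x\<in>A. \<exists>y\<in>B'. (x, y) \<in> parcs (Cay H S)"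
    if "B' \<subseteq> carrier H" "n_star n S chi < sqrt (real (card A) * real (card B'))" for B'
    using Cay_edge_if_n_star_less[of S chi A B'] assms(2-4,6,7) sub that by (simp add: n)
  have loopless: "x \<noteq> y" if "\<one>\<^bsub>H\<^esub> \<notin> S" "(x, y) \<in> parcs (Cay H S)" for x y
    using that by (auto simp: Cay_def)
  show ?thesis
  proof (intro conjI impI)
    assume "n_star n S chi < sqrt (real (card A) * real (card B))"
    then show "\<exists>x\<in>A. \<exists>y\<in>B. (x, y) \<in> parcs (Cay H S)"
      using edge sub(2) by blast
  next
    assume "\<one>\<^bsub>H\<^esub> \<notin> S \<and> n_star n S chi < real (card A)"
    then show "\<exists>x\<in>A. \<exists>y\<in>A. x \<noteq> y \<and> (x, y) \<in> parcs (Cay H S)"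
      using edge[OF sub(1)] loopless by auto
  qed
qed

end
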